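(* Let $a\in\mathbb{R}$, $b>0$, $\tau>0$. Let $Z'\sim\mathrm{AL}(0,a,b)$, let $\eta$ be a random variable independent of $Z'$ with mean zero and variance $\tau^2$, and let $W=Z'+\eta$. Let $Z\sim\mathrm{AL}(0,a,\sqrt{b^2+\tau^2})$ and $$c=\frac{14}{\sqrt{a^2+2b^2+2\tau^2}}+\frac{7|a|}{b^2+\tau^2},\quad d=5+\frac{7|a|}{\sqrt{a^2+2b^2+2\tau^2}}.$$ (i) Then $$d_\mathrm{K}(W,Z)\leq1.05\left(\frac{b^2c^2d\tau^2}{b^2+\tau^2}\right)^{1/3}+\frac{d\tau^2}{b^2+\tau^2},\qquad d_\mathrm{W}(W,Z)\leq \tau+\frac{\tau^2}{\sqrt{2b^2+a^2}}.$$ (ii) Suppose further that for some $n\geq2$ there exists $C>0$ such that $$\mathbb{P}\left(|\eta|>s\right)\leq\frac{C\tau^n}{s^n}$$ for all $s>0$. Then the order $\tau^{2/3}$ rate in the Kolmogorov distance bound of (i) can be improved to order $\tau^{n/(n+1)}$: $$d_\mathrm{K}(W,Z)\leq 2\left(\frac{2b^2c^nCd\tau^n}{(b^2+\tau^2)(n^2+3n+2)}\right)^{1/(n+1)}+\frac{d\tau^2}{b^2+\tau^2}.$$ (iii) Let $0<\tau<1$ and suppose now that $\eta\sim\mathrm{N}(0,\tau^2)$ (so that $W$ follows the normal-asymmetric Laplace distribution). Then $$d_\mathrm{K}(W,Z)\leq \bigg(2c+\frac{b^2d}{2\sqrt{2\pi}(b^2+\tau^2)\log(1/\tau)}\bigg)\tau\sqrt{\log(1/\tau)}+\frac{d\tau^2}{b^2+\tau^2},$$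 $$d_\mathrm{W}(W,Z)\leq \sqrt{\frac{2}{\pi}}\tau+\frac{\tau^2}{\sqrt{2b^2+a^2}}.$$
   Context: For $a\in\mathbb{R}$, $b>0$, $\mathrm{AL}(0,a,b)$ is the asymmetric Laplace distribution, with characteristic function $\dfrac{1}{1+b^2t^2/2-\mathrm{i}at}$, equivalently density $\dfrac{1}{\sqrt{2b^2+a^2}}\exp\big(\frac{a}{b^2}x-\frac{1}{b}\sqrt{2+\frac{a^2}{b^2}}\,|x|\big)$, $x\in\mathbb{R}$. For a class $\mathcal{H}$ of test functions, $d_{\mathcal{H}}(X,Y)=\sup_{h\in\mathcal{H}}|\mathbb{E}[h(X)]-\mathbb{E}[h(Y)]|$. The Kolmogorov distance $d_\mathrm{K}$ and Wasserstein distance $d_\mathrm{W}$ correspond respectively to $\mathcal{H}_\mathrm{K}=\{\mathbb{I}_{\cdot\leq z}\,|\,z\in\mathbb{R}\}$ and $\mathcal{H}_\mathrm{W}=\{h:\mathbb{R}\to\mathbb{R}\,|\,h\text{ Lipschitz},\ \|h'\|\leq1\}$, where $\|\cdot\|$ is the essential supremum norm on $\mathbb{R}$. *)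

theory Defs
  imports "HOL-Probability.Probability"
begin

text \<open>Density of the asymmetric Laplace distribution AL(0,a,b), for b > 0. Its characteristic
  function is 1 / (1 + b^2 t^2 / 2 - i a t).\<close>

definition AL_density :: "real \<Rightarrow> real \<Rightarrow> real \<Rightarrow> real" where
  "AL_density a b x =
     1 / sqrt (2 * b\<^sup>2 + a\<^sup>2) * exp (a / b\<^sup>2 * x - 1 / b * sqrt (2 + a\<^sup>2 / b\<^sup>2) * \<bar>x\<bar>)"

text \<open>The supremum is taken in the extended reals, so it is the true supremum (possibly infinite)
  and not an arbitrary value when the set of differences is unbounded. The two random variables may
  live on different probability spaces.\<close>

definition ipm ::
  "(real \<Rightarrow> real) set \<Rightarrow> 'a measure \<Rightarrow> ('a \<Rightarrow> real) \<Rightarrow> 'b measure \<Rightarrow> ('b \<Rightarrow> real) \<Rightarrow> ereal" where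
  "ipm H M X N Y = (SUP h\<in>H. ereal \<bar>(\<integral>\<omega>. h (X \<omega>) \<partial>M) - (\<integral>\<omega>. h (Y \<omega>) \<partial>N)\<bar>)"

definition H_K :: "(real \<Rightarrow> real) set" where
  "H_K = {indicator {..z} | z. True}"

text \<open>For Lipschitz h the derivative exists almost everywhere (Rademacher), so the second conjunct
  excludes no function; it records that \<^term>\<open>deriv h\<close>, which is arbitrary where h is not
  differentiable, represents h' almost everywhere.\<close>

definition H_W :: "(real \<Rightarrow> real) set" where
  "H_W = {h. (\<exists>L. L-lipschitz_on UNIV h) \<and>
             (AE x in lebesgue. h field_differentiable at x) \<and>
             esssup lebesgue (\<lambda>x. ereal \<bar>deriv h x\<bar>) \<le> 1}"

definition d_K :: "'a measure \<Rightarrow> ('a \<Rightarrow> real) \<Rightarrow> 'b measure \<Rightarrow> ('b \<Rightarrow> real) \<Rightarrow> ereal" where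
  "d_K = ipm H_K"

definition d_W :: "'a measure \<Rightarrow> ('a \<Rightarrow> real) \<Rightarrow> 'b measure \<Rightarrow> ('b \<Rightarrow> real) \<Rightarrow> ereal" where
  "d_W = ipm H_W"

end

theory Submission
  imports Defs
begin

text \<open>
  Write \<open>S = sqrt (2 * b\<^sup>2 + a\<^sup>2)\<close>. The law AL(0,a,b) is a mixture of an exponential law on the right
  half-line with mean \<open>m = (S + a) / 2\<close> and a reflected exponential law on the left half-line with mean
  \<open>l = (S - a) / 2\<close>, with weights proportional to these means. Replacing \<open>b\<^sup>2\<close> by \<open>b\<^sup>2 + \<tau>\<^sup>2\<close> increases
  both means by the same number \<open>k\<close>, and \<open>2 * k \<le> \<tau>\<^sup>2 / S\<close>. Driving both mixtures by the same standard
  exponential variable shows that the laws of \<open>Z'\<close> and \<open>Z\<close> are at Wasserstein distance at most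
  \<open>2 * k\<close> (\<open>integral_AL_diff_contraction\<close>) and at Kolmogorov distance at most \<open>3 * k / S\<close>
  (\<open>integral_AL_diff_atMost\<close>).

  For the Wasserstein distance it remains to pass from \<open>Z'\<close> to \<open>W = Z' + \<eta>\<close>, which costs \<open>E \<bar>\<eta>\<bar>\<close>: this
  is at most \<open>\<tau>\<close> in general, and equal to \<open>sqrt (2 / pi) * \<tau>\<close> for Gaussian noise. The test functions are
  given through an almost everywhere bound on their derivative, and \<open>H_W_contraction\<close> turns this into
  the inequality \<open>\<bar>h x - h y\<bar> \<le> \<bar>x - y\<bar>\<close>.

  For the Kolmogorov distance the passage from \<open>Z'\<close> to \<open>W\<close> is of second order in \<open>\<tau>\<close>, because the density
  of \<open>Z'\<close> is Lipschitz with constant \<open>2 / b\<^sup>2\<close> and the independent noise is centred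
  (\<open>cdf_add_indep_centered_noise\<close>). Together with the trivial bound by one, this gives a Kolmogorov
  distance of at most \<open>5 * \<tau>\<^sup>2 / (b\<^sup>2 + \<tau>\<^sup>2)\<close> (\<open>Kolmogorov_AL_noise_le\<close>). As \<open>5 \<le> d\<close>, this is at most the
  summand \<open>d * \<tau>\<^sup>2 / (b\<^sup>2 + \<tau>\<^sup>2)\<close> shared by the three Kolmogorov bounds, whose other summands are
  nonnegative.
\<close>

section \<open>Asymmetric Laplace laws as two-sided exponential laws\<close>

lemma abs_exp_minus_diff_le:
  fixes u v :: real
  assumes "0 \<le> u" "0 \<le> v"
  shows "\<bar>exp (- u) - exp (- v)\<bar> \<le> \<bar>u - v\<bar>"
proof -
  have step: "exp (- x) - exp (- y) \<le> \<bar>x - y\<bar>" if "0 \<le> x" for x y :: real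
  proof (cases "x \<le> y")
    case True
    have "exp (- x) - exp (- y) = exp (- x) * (1 - exp (x - y))"
      by (simp add: algebra_simps flip: exp_add)
    also have "\<dots> \<le> 1 * (y - x)"
    proof (rule mult_mono)
      show "1 - exp (x - y) \<le> y - x" using exp_ge_add_one_self[of "x - y"] by linarith
    qed (use that True in auto)
    finally show ?thesis using True by simp
  next
    case False
    then have "exp (- x) \<le> exp (- y)" by simp
    then show ?thesis by linarith
  qed
  show ?thesis
    using step[OF assms(1), of v] step[OF assms(2), of u] by (simp add: abs_le_iff abs_minus_commute)
qed

definition two_sided_exp_density :: "real \<Rightarrow> real \<Rightarrow> real \<Rightarrow> real" where
  "two_sided_exp_density m l x = (if 0 \<le> x then exp (- x / m) else exp (x / l)) / (m + l)"

text \<open>The asymmetric Laplace law is the law of a difference of two independent exponential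
  variables, and the following two numbers are their means: their difference is \<^term>\<open>a\<close> and their
  product is \<^term>\<open>b\<^sup>2 / 2\<close>, which matches the factorisation of the polynomial in the denominator of
  the characteristic function.\<close>

definition AL_mean_right :: "real \<Rightarrow> real \<Rightarrow> real" where
  "AL_mean_right a b = (sqrt (2 * b\<^sup>2 + a\<^sup>2) + a) / 2"

definition AL_mean_left :: "real \<Rightarrow> real \<Rightarrow> real" where
  "AL_mean_left a b = (sqrt (2 * b\<^sup>2 + a\<^sup>2) - a) / 2"

lemma abs_less_AL_sqrt: "0 < b \<Longrightarrow> \<bar>a\<bar> < sqrt (2 * b\<^sup>2 + a\<^sup>2)"
  by (rule real_less_rsqrt) simp

lemma AL_rate_eq: "0 < b \<Longrightarrow> 1 / b * sqrt (2 + a\<^sup>2 / b\<^sup>2) = sqrt (2 * b\<^sup>2 + a\<^sup>2) / b\<^sup>2"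
proof -
  assume "0 < b"
  then have "sqrt (2 + a\<^sup>2 / b\<^sup>2) = sqrt ((2 * b\<^sup>2 + a\<^sup>2) / b\<^sup>2)"
    by (intro arg_cong[where f=sqrt]) (simp add: field_simps)
  also have "\<dots> = sqrt (2 * b\<^sup>2 + a\<^sup>2) / b"
    using \<open>0 < b\<close> by (simp add: real_sqrt_divide)
  finally show ?thesis by (simp add: power2_eq_square)
qed

lemma AL_mean_pos:
  assumes "0 < b"
  shows "0 < AL_mean_right a b" "0 < AL_mean_left a b"
  using abs_less_AL_sqrt[OF assms, of a] by (auto simp: AL_mean_right_def AL_mean_left_def)

lemma AL_mean_sum: "AL_mean_right a b + AL_mean_left a b = sqrt (2 * b\<^sup>2 + a\<^sup>2)"
  by (simp add: AL_mean_right_def AL_mean_left_def field_simps)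

lemma AL_mean_mult: "AL_mean_right a b * AL_mean_left a b = b\<^sup>2 / 2"
proof -
  have "AL_mean_right a b * AL_mean_left a b = ((sqrt (2 * b\<^sup>2 + a\<^sup>2))\<^sup>2 - a\<^sup>2) / 4"
    by (simp add: AL_mean_right_def AL_mean_left_def algebra_simps power2_eq_square del: real_sqrt_mult_self real_sqrt_pow2_iff)
  then show ?thesis by simp
qed

text \<open>The exponent of the density is linear on each half-line, with slopes
  \<^term>\<open>(a - sqrt (2 * b\<^sup>2 + a\<^sup>2)) / b\<^sup>2\<close> and \<^term>\<open>(a + sqrt (2 * b\<^sup>2 + a\<^sup>2)) / b\<^sup>2\<close>; since the product of
  the means is \<^term>\<open>b\<^sup>2 / 2\<close>, these are the negative reciprocal of the right mean and the
  reciprocal of the left mean.\<close>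

lemma AL_density_eq_two_sided_exp:
  assumes "0 < b"
  shows "AL_density a b = two_sided_exp_density (AL_mean_right a b) (AL_mean_left a b)"
proof
  fix x
  let ?S = "sqrt (2 * b\<^sup>2 + a\<^sup>2)" and ?m = "AL_mean_right a b" and ?l = "AL_mean_left a b"
  have b2: "b\<^sup>2 = 2 * (?m * ?l)" by (simp add: AL_mean_mult)
  have S: "?S = ?m + ?l" by (simp add: AL_mean_sum)
  have a: "a - ?S = - (2 * ?l)" "a + ?S = 2 * ?m"
    by (simp_all add: AL_mean_right_def AL_mean_left_def field_simps)
  have pos: "0 < ?m" "0 < ?l" using AL_mean_pos[OF assms] by auto
  have r: "(a - ?S) / b\<^sup>2 = - 1 / ?m" "(a + ?S) / b\<^sup>2 = 1 / ?l"
    unfolding a using pos by (simp_all add: b2)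
  have "AL_density a b x = 1 / ?S * exp (a / b\<^sup>2 * x - ?S / b\<^sup>2 * \<bar>x\<bar>)"
    unfolding AL_density_def AL_rate_eq[OF assms] ..
  moreover have "a / b\<^sup>2 * x - ?S / b\<^sup>2 * \<bar>x\<bar> = (if 0 \<le> x then (a - ?S) / b\<^sup>2 * x else (a + ?S) / b\<^sup>2 * x)"
    by (simp add: algebra_simps add_divide_distrib diff_divide_distrib)
  ultimately have "AL_density a b x = 1 / ?S * exp (if 0 \<le> x then (a - ?S) / b\<^sup>2 * x else (a + ?S) / b\<^sup>2 * x)"
    by simp
  then show "AL_density a b x = two_sided_exp_density ?m ?l x"
    unfolding r unfolding S two_sided_exp_density_def by simp
qed

lemma AL_density_nonneg: "0 \<le> AL_density a b x"
  by (simp add: AL_density_def)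

lemma AL_density_measurable [measurable]: "AL_density a b \<in> borel_measurable borel"
  unfolding AL_density_def[abs_def] by measurable

text \<open>The density is a normalising constant times \<open>exp (- \<psi>)\<close> with \<open>\<psi>\<close> nonnegative and piecewise
  linear, and \<open>t \<mapsto> exp (- t)\<close> is a contraction on the nonnegative half-line. The slopes of \<open>\<psi>\<close> are
  at most \<open>2 * S / b\<^sup>2\<close> for \<open>S = sqrt (2 * b\<^sup>2 + a\<^sup>2)\<close>, because \<open>\<bar>a\<bar> \<le> S\<close>, and the normalising constant
  \<open>1 / S\<close> cancels the factor \<open>S\<close>.\<close>

lemma AL_density_Lipschitz:
  assumes "0 < b"
  shows "\<bar>AL_density a b x - AL_density a b y\<bar> \<le> 2 / b\<^sup>2 * \<bar>x - y\<bar>"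
proof -
  let ?S = "sqrt (2 * b\<^sup>2 + a\<^sup>2)"
  define \<psi> where "\<psi> t = ?S / b\<^sup>2 * \<bar>t\<bar> - a / b\<^sup>2 * t" for t
  have S: "\<bar>a\<bar> < ?S" by (rule abs_less_AL_sqrt[OF assms])
  have dens: "AL_density a b t = 1 / ?S * exp (- \<psi> t)" for t
    unfolding AL_density_def AL_rate_eq[OF assms] \<psi>_def by simp
  have nonneg: "0 \<le> \<psi> t" for t
  proof -
    have "a * t \<le> \<bar>a\<bar> * \<bar>t\<bar>" by (simp flip: abs_mult)
    also have "\<dots> \<le> ?S * \<bar>t\<bar>" using S by (intro mult_right_mono) auto
    finally have "0 \<le> (?S * \<bar>t\<bar> - a * t) / b\<^sup>2" by simp
    then show ?thesis by (simp add: \<psi>_def diff_divide_distrib)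
  qed
  have lip: "\<bar>\<psi> x - \<psi> y\<bar> \<le> 2 * ?S / b\<^sup>2 * \<bar>x - y\<bar>"
  proof -
    have "\<psi> x - \<psi> y = (?S * (\<bar>x\<bar> - \<bar>y\<bar>) - a * (x - y)) / b\<^sup>2"
      by (simp add: \<psi>_def algebra_simps diff_divide_distrib add_divide_distrib)
    moreover have "\<bar>?S * (\<bar>x\<bar> - \<bar>y\<bar>) - a * (x - y)\<bar> \<le> ?S * \<bar>\<bar>x\<bar> - \<bar>y\<bar>\<bar> + \<bar>a\<bar> * \<bar>x - y\<bar>"
      by (rule order_trans[OF abs_triangle_ineq4]) (simp add: abs_mult)
    moreover have "\<dots> \<le> ?S * \<bar>x - y\<bar> + ?S * \<bar>x - y\<bar>"
      using S by (intro add_mono mult_left_mono mult_right_mono) auto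
    ultimately have "\<bar>\<psi> x - \<psi> y\<bar> \<le> (?S * \<bar>x - y\<bar> + ?S * \<bar>x - y\<bar>) / b\<^sup>2"
      by (simp only: abs_divide abs_power2) (intro divide_right_mono, linarith, simp)
    then show ?thesis by (simp add: algebra_simps)
  qed
  have "\<bar>AL_density a b x - AL_density a b y\<bar> = 1 / ?S * \<bar>exp (- \<psi> x) - exp (- \<psi> y)\<bar>"
    unfolding dens by (simp add: abs_mult flip: right_diff_distrib diff_divide_distrib)
  also have "\<dots> \<le> 1 / ?S * (2 * ?S / b\<^sup>2 * \<bar>x - y\<bar>)"
    by (intro mult_left_mono order_trans[OF abs_exp_minus_diff_le[OF nonneg nonneg] lip]) simp
  also have "\<dots> = 2 / b\<^sup>2 * \<bar>x - y\<bar>"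
  proof -
    have "?S \<noteq> 0" using abs_ge_zero[of a] S by linarith
    then show ?thesis by (simp del: real_sqrt_eq_zero_cancel_iff)
  qed
  finally show ?thesis .
qed

text \<open>Adding \<^term>\<open>\<tau>\<^sup>2\<close> to \<^term>\<open>b\<^sup>2\<close> keeps the difference of the two means, so both grow by the same
  amount, half the increment of the square root. Rationalising that increment gives its size.\<close>

lemma AL_mean_increment:
  fixes a b \<tau> :: real
  assumes "0 < b"
  defines "S \<equiv> sqrt (2 * b\<^sup>2 + a\<^sup>2)"
  obtains k where "0 \<le> k" "2 * k \<le> \<tau>\<^sup>2 / S"
    "AL_mean_right a (sqrt (b\<^sup>2 + \<tau>\<^sup>2)) = AL_mean_right a b + k"
    "AL_mean_left a (sqrt (b\<^sup>2 + \<tau>\<^sup>2)) = AL_mean_left a b + k"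
proof
  define T where "T = sqrt (2 * (b\<^sup>2 + \<tau>\<^sup>2) + a\<^sup>2)"
  have S: "0 < S" using assms by (simp add: S_def add_pos_nonneg)
  have ST: "S \<le> T" by (simp add: S_def T_def)
  have "(T - S) * (T + S) = T\<^sup>2 - S\<^sup>2" by (simp add: algebra_simps power2_eq_square)
  also have "\<dots> = 2 * \<tau>\<^sup>2" by (simp add: S_def T_def)
  finally have "(T - S) * (T + S) = 2 * \<tau>\<^sup>2" .
  moreover have "(T - S) * (2 * S) \<le> (T - S) * (T + S)"
    using ST by (intro mult_left_mono) auto
  ultimately have "(T - S) * S \<le> \<tau>\<^sup>2" by simp
  then show "2 * ((T - S) / 2) \<le> \<tau>\<^sup>2 / S" using S by (simp add: field_simps)
  show "0 \<le> (T - S) / 2" using ST by simp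
  show "AL_mean_right a (sqrt (b\<^sup>2 + \<tau>\<^sup>2)) = AL_mean_right a b + (T - S) / 2"
    "AL_mean_left a (sqrt (b\<^sup>2 + \<tau>\<^sup>2)) = AL_mean_left a b + (T - S) / 2"
    by (simp_all add: AL_mean_right_def AL_mean_left_def S_def T_def field_simps)
qed

section \<open>Two-sided exponential laws as mixtures\<close>

abbreviation std_exponential :: "real measure" where
  "std_exponential \<equiv> density lborel (\<lambda>u. ennreal (exponential_density 1 u))"

interpretation std_exponential: prob_space std_exponential
  by (rule prob_space_exponential_density) simp

lemma std_exponential_prob_UNIV [simp]: "measure std_exponential UNIV = 1"
  using std_exponential.prob_space by simp

lemma std_exponential_distributed:
  "distributed std_exponential lborel (\<lambda>u. u) (exponential_density 1)"
  unfolding distributed_def by (simp add: distr_id2)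

lemma std_exponential_AE_nonneg: "AE u in std_exponential. 0 \<le> u"
  by (subst AE_density) (auto simp: exponential_density_def)

lemma integrable_std_exponential_id: "integrable std_exponential (\<lambda>u. u)"
  using std_exponential.erlang_ith_moment_integrable[OF _ std_exponential_distributed, of 1] by simp

lemma integral_std_exponential_id: "(\<integral>u. u \<partial>std_exponential) = 1"
  using std_exponential.exponential_distributed_expectation[OF _ std_exponential_distributed] by simp

text \<open>Both functions are evaluated at the same exponential variable, which has mean one: this is a
  coupling bound.\<close>

lemma integral_std_exponential_diff_le:
  assumes "integrable std_exponential f" "integrable std_exponential g"
    and "\<And>u. 0 \<le> u \<Longrightarrow> \<bar>f u - g u\<bar> \<le> K * u"
  shows "\<bar>(\<integral>u. f u \<partial>std_exponential) - (\<integral>u. g u \<partial>std_exponential)\<bar> \<le> K"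
proof -
  have "\<bar>(\<integral>u. f u \<partial>std_exponential) - (\<integral>u. g u \<partial>std_exponential)\<bar> = \<bar>\<integral>u. f u - g u \<partial>std_exponential\<bar>"
    using assms by simp
  also have "\<dots> \<le> (\<integral>u. \<bar>f u - g u\<bar> \<partial>std_exponential)"
    by (rule integral_abs_bound)
  also have "\<dots> \<le> (\<integral>u. K * u \<partial>std_exponential)"
  proof (rule integral_mono_AE)
    show "AE u in std_exponential. \<bar>f u - g u\<bar> \<le> K * u"
      using std_exponential_AE_nonneg by eventually_elim (rule assms(3))
  qed (use assms integrable_std_exponential_id in auto)
  also have "\<dots> = K" by (simp add: integral_std_exponential_id)
  finally show ?thesis .
qed

text \<open>The two-sided exponential law is a mixture: with weights proportional to \<^term>\<open>m\<close> and \<^term>\<open>l\<close> it is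
  the law of \<^term>\<open>m * u\<close> or of \<^term>\<open>- l * u\<close> for a standard exponential variable \<^term>\<open>u\<close>.\<close>

lemma integral_two_sided_exp:
  fixes h :: "real \<Rightarrow> real"
  assumes pos: "0 < m" "0 < l" and [measurable]: "h \<in> borel_measurable borel"
    and right: "integrable std_exponential (\<lambda>u. h (m * u))"
    and left: "integrable std_exponential (\<lambda>u. h (- l * u))"
  shows "has_bochner_integral lborel (\<lambda>x. two_sided_exp_density m l x * h x)
    (m / (m + l) * (\<integral>u. h (m * u) \<partial>std_exponential)
     + l / (m + l) * (\<integral>u. h (- l * u) \<partial>std_exponential))"
proof -
  have half: "has_bochner_integral lborel (\<lambda>x. exponential_density 1 (x / c) * h x)
      (\<bar>c\<bar> * (\<integral>u. h (c * u) \<partial>std_exponential))"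
    if "c \<noteq> 0" and int: "integrable std_exponential (\<lambda>u. h (c * u))" for c
  proof -
    have [measurable]: "(\<lambda>u. h (c * u)) \<in> borel_measurable borel" by measurable
    have 1: "(\<integral>u. h (c * u) \<partial>std_exponential) = (\<integral>u. exponential_density 1 u * h (c * u) \<partial>lborel)"
      by (subst integral_density) (auto simp: exponential_density_nonneg)
    have 2: "integrable lborel (\<lambda>u. exponential_density 1 u * h (c * u))"
      using int by (subst (asm) integrable_density) (auto simp: exponential_density_nonneg)
    show ?thesis
      using 2 that(1)
        lborel_integral_real_affine[OF that(1), of "\<lambda>x. exponential_density 1 (x / c) * h x" 0]
        lborel_integrable_real_affine_iff[OF that(1), of "\<lambda>x. exponential_density 1 (x / c) * h x" 0]
      unfolding has_bochner_integral_iff 1 by simp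
  qed
  have "has_bochner_integral lborel
     (\<lambda>x. (exponential_density 1 (x / m) * h x + exponential_density 1 (x / - l) * h x) / (m + l))
     ((\<bar>m\<bar> * (\<integral>u. h (m * u) \<partial>std_exponential) + \<bar>- l\<bar> * (\<integral>u. h (- l * u) \<partial>std_exponential)) / (m + l))"
    using pos right left
    by (intro has_bochner_integral_divide has_bochner_integral_add half) auto
  \<comment> \<open>At the origin both one-sided densities are positive, so the identity fails there.\<close>
  moreover have "AE x in lborel.
     (exponential_density 1 (x / m) * h x + exponential_density 1 (x / - l) * h x) / (m + l)
     = two_sided_exp_density m l x * h x"
    using AE_lborel_singleton[of "0::real"]
    by eventually_elim
      (use pos in \<open>auto simp: exponential_density_def two_sided_exp_density_def field_simps\<close>)
  ultimately have "has_bochner_integral lborel (\<lambda>x. two_sided_exp_density m l x * h x)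
     ((\<bar>m\<bar> * (\<integral>u. h (m * u) \<partial>std_exponential) + \<bar>- l\<bar> * (\<integral>u. h (- l * u) \<partial>std_exponential)) / (m + l))"
    by (subst (asm) has_bochner_integral_cong_AE) (auto simp: two_sided_exp_density_def)
  then show ?thesis using pos by (simp add: add_divide_distrib)
qed

text \<open>When both means grow by the same \<^term>\<open>k\<close>, two things change in the mixture: the scales, and the
  weights. With the old weights kept on the changes of scale, the change of weight
  \<^term>\<open>k * (l - m) / ((m + l) * (m + l + 2 * k))\<close> multiplies the difference of the two components at the
  new scales.\<close>

lemma integral_two_sided_exp_diff_le:
  fixes h :: "real \<Rightarrow> real" and m l k r s D :: real
  defines "R \<equiv> \<lambda>c. \<integral>u. h (c * u) \<partial>std_exponential"
  assumes pos: "0 < m" "0 < l" "0 \<le> k" and meas [measurable]: "h \<in> borel_measurable borel"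
    and int: "\<And>c. integrable std_exponential (\<lambda>u. h (c * u))"
    and right: "m * \<bar>R (m + k) - R m\<bar> \<le> r"
    and left: "l * \<bar>R (- (l + k)) - R (- l)\<bar> \<le> s"
    and cross: "\<bar>R (m + k) - R (- (l + k))\<bar> \<le> D"
  shows "\<bar>(\<integral>x. two_sided_exp_density (m + k) (l + k) x * h x \<partial>lborel) -
          (\<integral>x. two_sided_exp_density m l x * h x \<partial>lborel)\<bar>
     \<le> (r + s) / (m + l) + k * D / (m + l + 2 * k)"
proof -
  let ?S = "m + l"
  have S: "0 < ?S" "0 < ?S + 2 * k" using pos by auto
  have p: "(\<integral>x. two_sided_exp_density m l x * h x \<partial>lborel) = m / ?S * R m + l / ?S * R (- l)"
    using integral_two_sided_exp[OF pos(1,2) meas int int] unfolding R_def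
    by (rule has_bochner_integral_integral_eq)
  have "(\<integral>x. two_sided_exp_density (m + k) (l + k) x * h x \<partial>lborel)
      = (m + k) / ((m + k) + (l + k)) * R (m + k) + (l + k) / ((m + k) + (l + k)) * R (- (l + k))"
    using integral_two_sided_exp[OF _ _ meas int int, of "m + k" "l + k"] pos unfolding R_def
    by (intro has_bochner_integral_integral_eq) auto
  also have "\<dots> = (m + k) / (?S + 2 * k) * R (m + k) + (l + k) / (?S + 2 * k) * R (- (l + k))"
    by (simp add: algebra_simps)
  finally have q: "(\<integral>x. two_sided_exp_density (m + k) (l + k) x * h x \<partial>lborel) = \<dots>" .
  define \<gamma> where "\<gamma> = k / (?S + 2 * k) * ((l - m) / ?S)"
  have w: "(m + k) / (?S + 2 * k) = m / ?S + \<gamma>" "(l + k) / (?S + 2 * k) = l / ?S - \<gamma>"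
  proof -
    have n: "m * (?S + 2 * k) + k * (l - m) = (m + k) * ?S" "l * (?S + 2 * k) - k * (l - m) = (l + k) * ?S"
      by (simp_all add: algebra_simps)
    have n': "m / ?S + \<gamma> = (m * (?S + 2 * k) + k * (l - m)) / ((?S + 2 * k) * ?S)"
      "l / ?S - \<gamma> = (l * (?S + 2 * k) - k * (l - m)) / ((?S + 2 * k) * ?S)"
      using S unfolding add_divide_distrib[of "_ * _"] diff_divide_distrib[of "_ * _"] \<gamma>_def by simp_all
    show "(m + k) / (?S + 2 * k) = m / ?S + \<gamma>"
      unfolding n' n using S by simp
    show "(l + k) / (?S + 2 * k) = l / ?S - \<gamma>"
      unfolding n' n using S by simp
  qed
  have split: "(\<alpha> + \<gamma>) * x1 + (\<beta> - \<gamma>) * x2 - (\<alpha> * x3 + \<beta> * x4) =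
      \<alpha> * (x1 - x3) + \<beta> * (x2 - x4) + \<gamma> * (x1 - x2)" for \<alpha> \<beta> x1 x2 x3 x4
    by (simp add: algebra_simps)
  have sp: "(m * x + l * y) / ?S = m / ?S * x + l / ?S * y" for x y
    by (simp add: add_divide_distrib)
  have e: "(\<integral>x. two_sided_exp_density (m + k) (l + k) x * h x \<partial>lborel) -
          (\<integral>x. two_sided_exp_density m l x * h x \<partial>lborel)
     = (m * (R (m + k) - R m) + l * (R (- (l + k)) - R (- l))) / ?S
       + \<gamma> * (R (m + k) - R (- (l + k)))"
    unfolding p q w sp by (rule split)
  have "\<bar>m * (R (m + k) - R m) + l * (R (- (l + k)) - R (- l))\<bar> \<le> r + s"
    using pos right left by (intro order_trans[OF abs_triangle_ineq] add_mono) (auto simp: abs_mult)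
  then have A: "\<bar>(m * (R (m + k) - R m) + l * (R (- (l + k)) - R (- l))) / ?S\<bar> \<le> (r + s) / ?S"
    using S by (simp add: abs_divide divide_right_mono)
  have "\<bar>(l - m) / ?S\<bar> \<le> 1" using pos by (simp add: abs_divide)
  then have "\<bar>\<gamma> * (R (m + k) - R (- (l + k)))\<bar> \<le> k / (?S + 2 * k) * 1 * D"
    unfolding abs_mult \<gamma>_def using S pos cross by (intro mult_mono) (auto simp: abs_divide)
  with A show ?thesis unfolding e by (intro order_trans[OF abs_triangle_ineq]) auto
qed

section \<open>Wasserstein test functions\<close>

text \<open>A bound on the derivative almost everywhere controls a Lipschitz function. The difference quotients
  \<open>g n\<close> are uniformly bounded and converge almost everywhere to the derivative, so by dominated
  convergence the integrals of \<open>max 1 \<bar>g n\<bar>\<close> over an interval tend to its length. On the other hand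
  \<open>g n\<close> is the derivative of \<open>G\<close>, the average of the function over a window of width \<open>\<delta> = 1 / Suc n\<close> to the
  right, which is uniformly close to the function itself. Truncating from below by
  one makes the limit constant, so that no integral of the derivative occurs.\<close>

lemma H_W_contraction:
  assumes "h \<in> H_W"
  shows "\<bar>h x - h y\<bar> \<le> \<bar>x - y\<bar>"
proof -
  obtain L where L: "L-lipschitz_on UNIV h"
    and diff: "AE x in lebesgue. h field_differentiable at x"
    and ess: "esssup lebesgue (\<lambda>x. ereal \<bar>deriv h x\<bar>) \<le> 1"
    using assms unfolding H_W_def by blast
  have L0: "0 \<le> L" using L by (rule lipschitz_on_nonneg)
  have cont: "continuous_on UNIV h" using L by (rule lipschitz_on_continuous_on)
  then have [measurable]: "h \<in> borel_measurable borel" by (rule borel_measurable_continuous_onI)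
  have Lip: "\<bar>h x - h y\<bar> \<le> L * \<bar>x - y\<bar>" for x y
    using lipschitz_onD[OF L, of x y] by (simp add: dist_real_def)
  define g where "g n x = real (Suc n) * (h (x + 1 / real (Suc n)) - h x)" for n x
  have g_meas [measurable]: "g n \<in> borel_measurable borel" for n unfolding g_def[abs_def] by measurable
  have g_bound: "\<bar>g n x\<bar> \<le> L" for n x
  proof -
    have "\<bar>g n x\<bar> = real (Suc n) * \<bar>h (x + 1 / real (Suc n)) - h x\<bar>"
      unfolding g_def by (simp only: abs_mult abs_of_nat)
    also have "\<dots> \<le> real (Suc n) * (L * (1 / real (Suc n)))"
      using Lip[of "x + 1 / real (Suc n)" x] by (intro mult_left_mono) auto
    finally show ?thesis by simp
  qed
  define B where "B = max 1 L"
  have max_bound: "max 1 \<bar>g n x\<bar> \<le> B" for n x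
    unfolding B_def using g_bound[of n x] by (intro max.mono) auto
  have "AE x in lebesgue. (\<lambda>n. max 1 \<bar>g n x\<bar>) \<longlonglongrightarrow> 1"
    using diff esssup_AE[of "\<lambda>x. ereal \<bar>deriv h x\<bar>" lebesgue]
  proof eventually_elim
    case (elim x)
    have d: "\<bar>deriv h x\<bar> \<le> 1" using order_trans[OF elim(2) ess] by simp
    have "(h has_field_derivative deriv h x) (at x)"
      using elim(1) by (simp add: field_differentiable_derivI)
    then have "((\<lambda>t. (h (x + t) - h x) / t) \<longlongrightarrow> deriv h x) (at 0)"
      by (simp add: DERIV_def)
    moreover have "filterlim (\<lambda>n. 1 / real (Suc n)) (at 0) sequentially"
      by (intro filterlim_atI LIMSEQ_Suc[OF lim_1_over_n]) auto
    ultimately have "(\<lambda>n. (h (x + 1 / real (Suc n)) - h x) / (1 / real (Suc n))) \<longlonglongrightarrow> deriv h x"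
      by (rule filterlim_compose)
    then have "(\<lambda>n. g n x) \<longlonglongrightarrow> deriv h x" by (simp add: g_def mult.commute)
    then have "(\<lambda>n. max 1 \<bar>g n x\<bar>) \<longlonglongrightarrow> max 1 \<bar>deriv h x\<bar>"
      by (intro tendsto_max tendsto_const tendsto_rabs)
    then show ?case using d by (simp add: max_absorb1)
  qed
  then have lim: "AE x in lborel. (\<lambda>n. max 1 \<bar>g n x\<bar>) \<longlonglongrightarrow> 1"
    by (simp add: AE_completion_iff)
  have ordered: "\<bar>h v - h u\<bar> \<le> v - u" if "u < v" for u v
  proof -
    let ?I = "indicator {u..v} :: real \<Rightarrow> real"
    have intI: "integrable lborel (\<lambda>x. ?I x * f x)" if "f \<in> borel_measurable borel" "\<And>x. \<bar>f x\<bar> \<le> B'" for f B'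
      using that
      by (intro Bochner_Integration.integrable_bound[of lborel "\<lambda>x. ?I x * B'" "\<lambda>x. ?I x * f x"])
        (auto simp: abs_mult emeasure_lborel_Icc_eq intro!: AE_I2 mult_left_mono
          intro: order_trans[OF _ abs_ge_self])
    have "(\<lambda>n. \<integral>x. ?I x * max 1 \<bar>g n x\<bar> \<partial>lborel) \<longlonglongrightarrow> (\<integral>x. ?I x * 1 \<partial>lborel)"
    proof (rule integral_dominated_convergence)
      show "AE x in lborel. (\<lambda>n. ?I x * max 1 \<bar>g n x\<bar>) \<longlonglongrightarrow> ?I x * 1"
        using lim by eventually_elim (intro tendsto_mult tendsto_const)
      show "integrable lborel (\<lambda>x. ?I x * B)" by (rule intI[where B'=B]) (auto simp: B_def)
      show "AE x in lborel. norm (?I x * max 1 \<bar>g n x\<bar>) \<le> ?I x * B" for n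
        using max_bound[of n] by (auto simp: indicator_def intro!: AE_I2)
    qed auto
    then have up: "(\<lambda>n. \<integral>x. ?I x * max 1 \<bar>g n x\<bar> \<partial>lborel) \<longlonglongrightarrow> v - u"
      using that by simp
    have low: "\<bar>h v - h u\<bar> - 2 * L / real (Suc n) \<le> (\<integral>x. ?I x * max 1 \<bar>g n x\<bar> \<partial>lborel)" for n
    proof -
      define \<delta> where "\<delta> = 1 / real (Suc n)"
      have \<delta>: "0 < \<delta>" "\<delta> \<le> 1" by (auto simp: \<delta>_def)
      have "continuous_on {u - 1..v + 2} h" using cont by (rule continuous_on_subset) simp
      from antiderivative_continuous[OF this] obtain H
        where "\<And>x. x \<in> {u - 1..v + 2} \<Longrightarrow> (H has_vector_derivative h x) (at x within {u - 1..v + 2})"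
        by blast
      then have H: "(H has_real_derivative h x) (at x)" if "u - 1 < x" "x < v + 2" for x
        using that at_within_Icc_at[of "u - 1" x "v + 2"]
        by (metis atLeastAtMost_iff less_imp_le has_real_derivative_iff_has_vector_derivative)
      define G where "G x = (H (x + \<delta>) - H x) / \<delta>" for x
      have G: "(G has_real_derivative g n x) (at x)" if "u \<le> x" "x \<le> v" for x
      proof -
        have "((\<lambda>x. H (x + \<delta>)) has_real_derivative h (x + \<delta>)) (at x)"
          using H[of "x + \<delta>"] that \<delta> by (simp add: DERIV_shift)
        moreover have "(H has_real_derivative h x) (at x)" using H[of x] that by simp
        ultimately have "(G has_real_derivative (h (x + \<delta>) - h x) / \<delta>) (at x)"
          unfolding G_def[abs_def] by (intro DERIV_cdivide DERIV_diff)
        then show ?thesis by (simp add: g_def \<delta>_def mult.commute)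
      qed
      have G_near: "\<bar>G x - h x\<bar> \<le> L * \<delta>" if "u \<le> x" "x \<le> v" for x
      proof -
        have "(H has_real_derivative h t) (at t)" if "x \<le> t" "t \<le> x + \<delta>" for t
          using \<open>u \<le> x\<close> \<open>x \<le> v\<close> that \<delta> by (intro H) auto
        then obtain z where z: "x < z" "z < x + \<delta>" "H (x + \<delta>) - H x = (x + \<delta> - x) * h z"
          using MVT2[of x "x + \<delta>" H h] \<delta> by auto
        have "G x = h z" using z(3) \<delta> by (simp add: G_def)
        moreover have "L * \<bar>z - x\<bar> \<le> L * \<delta>" using z L0 by (intro mult_left_mono) auto
        ultimately show ?thesis using Lip[of z x] by simp
      qed
      have "continuous_on UNIV (g n)"
        unfolding g_def[abs_def] by (intro continuous_intros continuous_on_compose2[OF cont]) auto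
      then have "isCont (g n) x" for x by (simp add: continuous_on_eq_continuous_at)
      then have "(\<integral>x. g n x * ?I x \<partial>lborel) = G v - G u"
        using that G by (intro integral_FTC_Icc_real) auto
      then have "G v - G u = (\<integral>x. ?I x * g n x \<partial>lborel)" by (simp add: mult.commute)
      then have "\<bar>G v - G u\<bar> \<le> (\<integral>x. \<bar>?I x * g n x\<bar> \<partial>lborel)" by simp
      also have "\<dots> \<le> (\<integral>x. ?I x * max 1 \<bar>g n x\<bar> \<partial>lborel)"
      proof (rule integral_mono)
        show "integrable lborel (\<lambda>x. \<bar>?I x * g n x\<bar>)"
          using intI[of "g n" L] g_bound by auto
        show "integrable lborel (\<lambda>x. ?I x * max 1 \<bar>g n x\<bar>)"
          using max_bound[of n] by (intro intI[where B'=B]) auto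
      qed (auto simp: indicator_def)
      finally have "\<bar>G v - G u\<bar> \<le> \<dots>" .
      moreover have "L * \<delta> + L * \<delta> = 2 * L / real (Suc n)" by (simp add: \<delta>_def)
      ultimately show ?thesis using G_near[of u] G_near[of v] that by linarith
    qed
    have "(\<lambda>n. \<bar>h v - h u\<bar> - 2 * L / real (Suc n)) \<longlonglongrightarrow> \<bar>h v - h u\<bar> - 2 * L * 0"
      using LIMSEQ_Suc[OF lim_1_over_n[where 'a=real]]
      by (intro tendsto_diff tendsto_const) (auto dest: tendsto_mult_left[where c="2 * L"])
    from LIMSEQ_le[OF this up] low show ?thesis by auto
  qed
  show ?thesis
    using ordered[of x y] ordered[of y x] by (cases x y rule: linorder_cases) (auto simp: abs_minus_commute)
qed

lemma contraction_borel:
  fixes h :: "real \<Rightarrow> real"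
  assumes "\<And>x y. \<bar>h x - h y\<bar> \<le> \<bar>x - y\<bar>"
  shows "h \<in> borel_measurable borel"
proof -
  have "1-lipschitz_on UNIV h" using assms by (intro lipschitz_onI) (auto simp: dist_real_def)
  then show ?thesis by (intro borel_measurable_continuous_onI lipschitz_on_continuous_on)
qed

lemma integrable_contraction:
  fixes h :: "real \<Rightarrow> real"
  assumes "finite_measure M" and h: "\<And>x y. \<bar>h x - h y\<bar> \<le> \<bar>x - y\<bar>" and "integrable M X"
  shows "integrable M (\<lambda>\<omega>. h (X \<omega>))"
proof (rule Bochner_Integration.integrable_bound)
  interpret finite_measure M by fact
  show "integrable M (\<lambda>\<omega>. \<bar>h 0\<bar> + \<bar>X \<omega>\<bar>)" using assms(3) by simp
  have "\<bar>h x\<bar> \<le> \<bar>h 0\<bar> + \<bar>x\<bar>" for x using h[of x 0] by simp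
  then show "AE \<omega> in M. norm (h (X \<omega>)) \<le> norm (\<bar>h 0\<bar> + \<bar>X \<omega>\<bar>)"
    by (intro AE_I2) (auto intro: order_trans[OF _ abs_ge_self])
  note [measurable] = contraction_borel[OF h] borel_measurable_integrable[OF assms(3)]
  show "(\<lambda>\<omega>. h (X \<omega>)) \<in> borel_measurable M" by measurable
qed

section \<open>Dependence of asymmetric Laplace laws on the scale\<close>

lemma integrable_std_exponential_contraction:
  fixes h :: "real \<Rightarrow> real"
  assumes "\<And>x y. \<bar>h x - h y\<bar> \<le> \<bar>x - y\<bar>"
  shows "integrable std_exponential (\<lambda>u. h (c * u))"
  using integrable_contraction[OF std_exponential.finite_measure_axioms assms, of "\<lambda>u. c * u"]
    integrable_std_exponential_id by simp

lemma integrable_AL_contraction: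
  fixes h :: "real \<Rightarrow> real"
  assumes "0 < b" and h: "\<And>x y. \<bar>h x - h y\<bar> \<le> \<bar>x - y\<bar>"
  shows "integrable lborel (\<lambda>x. AL_density a b x * h x)"
  unfolding AL_density_eq_two_sided_exp[OF assms(1)]
  using integral_two_sided_exp[OF AL_mean_pos[OF assms(1)] contraction_borel[OF h]
      integrable_std_exponential_contraction[OF h] integrable_std_exponential_contraction[OF h],
      of a a]
  by (rule integrable.intros)

text \<open>The two changes of scale move the mass of the mixture by \<^term>\<open>k\<close> on average. A change of weights by
  at most \<open>k / (m + l + 2 * k)\<close> moves that mass from one component to the other, over an average distance
  of \<^term>\<open>m + l + 2 * k\<close>, at a further cost of \<^term>\<open>k\<close>. The sum is \<^term>\<open>2 * k\<close>.\<close>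

lemma integral_AL_diff_contraction:
  fixes h :: "real \<Rightarrow> real"
  assumes b: "0 < b" and h: "\<And>x y. \<bar>h x - h y\<bar> \<le> \<bar>x - y\<bar>"
  shows "\<bar>(\<integral>x. AL_density a (sqrt (b\<^sup>2 + \<tau>\<^sup>2)) x * h x \<partial>lborel) - (\<integral>x. AL_density a b x * h x \<partial>lborel)\<bar>
     \<le> \<tau>\<^sup>2 / sqrt (2 * b\<^sup>2 + a\<^sup>2)"
proof -
  obtain k where k: "0 \<le> k" "2 * k \<le> \<tau>\<^sup>2 / sqrt (2 * b\<^sup>2 + a\<^sup>2)"
    "AL_mean_right a (sqrt (b\<^sup>2 + \<tau>\<^sup>2)) = AL_mean_right a b + k"
    "AL_mean_left a (sqrt (b\<^sup>2 + \<tau>\<^sup>2)) = AL_mean_left a b + k"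
    using AL_mean_increment[OF b] by metis
  have b': "0 < sqrt (b\<^sup>2 + \<tau>\<^sup>2)" using b by (simp add: add_pos_nonneg)
  define m l where ml: "m = AL_mean_right a b" "l = AL_mean_left a b"
  have pos: "0 < m" "0 < l" using AL_mean_pos[OF b] by (auto simp: ml)
  note int = integrable_std_exponential_contraction[OF h]
  have "\<bar>(\<integral>x. two_sided_exp_density (m + k) (l + k) x * h x \<partial>lborel) -
          (\<integral>x. two_sided_exp_density m l x * h x \<partial>lborel)\<bar>
     \<le> (m * k + l * k) / (m + l) + k * (m + l + 2 * k) / (m + l + 2 * k)"
  proof (rule integral_two_sided_exp_diff_le[OF pos k(1) contraction_borel[OF h] int])
    show "m * \<bar>(\<integral>u. h ((m + k) * u) \<partial>std_exponential) - (\<integral>u. h (m * u) \<partial>std_exponential)\<bar> \<le> m * k"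
    proof (intro mult_left_mono integral_std_exponential_diff_le int)
      fix u :: real assume "0 \<le> u"
      then show "\<bar>h ((m + k) * u) - h (m * u)\<bar> \<le> k * u"
        using h[of "(m + k) * u" "m * u"] k(1) by (simp add: algebra_simps)
    qed (use pos in auto)
    show "l * \<bar>(\<integral>u. h (- (l + k) * u) \<partial>std_exponential) - (\<integral>u. h (- l * u) \<partial>std_exponential)\<bar> \<le> l * k"
    proof (intro mult_left_mono integral_std_exponential_diff_le int)
      fix u :: real assume "0 \<le> u"
      then show "\<bar>h (- (l + k) * u) - h (- l * u)\<bar> \<le> k * u"
        using h[of "- (l + k) * u" "- l * u"] k(1) by (simp add: algebra_simps)
    qed (use pos in auto)
    show "\<bar>(\<integral>u. h ((m + k) * u) \<partial>std_exponential) - (\<integral>u. h (- (l + k) * u) \<partial>std_exponential)\<bar> \<le> m + l + 2 * k"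
    proof (intro integral_std_exponential_diff_le int)
      fix u :: real assume "0 \<le> u"
      have "(m + k) * u - - (l + k) * u = (m + l + 2 * k) * u" by (simp add: algebra_simps)
      then show "\<bar>h ((m + k) * u) - h (- (l + k) * u)\<bar> \<le> (m + l + 2 * k) * u"
        using h[of "(m + k) * u" "- (l + k) * u"] k(1) pos \<open>0 \<le> u\<close> by simp
    qed
  qed
  also have "\<dots> = 2 * k"
    using pos k(1) by (simp flip: distrib_right)
  finally show ?thesis
    using k(2) unfolding AL_density_eq_two_sided_exp[OF b] AL_density_eq_two_sided_exp[OF b'] k(3,4) ml
    by linarith
qed

lemma integral_std_exponential_atMost:
  "(\<integral>u. indicator {..s} u \<partial>std_exponential) = (if 0 \<le> s then 1 - exp (- s) else (0::real))"
proof (cases "0 \<le> s")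
  case True
  have "(\<integral>u. indicator {..s} u \<partial>std_exponential) = std_exponential.prob {u \<in> space std_exponential. u \<le> s}"
    by (simp add: atMost_def)
  also have "\<dots> = 1 - exp (- s * 1)"
    by (rule std_exponential.exponential_distributedD_le[OF std_exponential_distributed True]) simp
  finally show ?thesis using True by simp
next
  case False
  have "(\<integral>u. indicator {..s} u \<partial>std_exponential) = (\<integral>u. (0::real) \<partial>std_exponential)"
  proof (rule integral_cong_AE)
    show "AE u in std_exponential. indicator {..s} u = (0::real)"
      using std_exponential_AE_nonneg by eventually_elim (use False in auto)
  qed auto
  then show ?thesis using False by simp
qed

text \<open>Rescaling an exponential variable from mean \<^term>\<open>c\<close> to mean \<^term>\<open>c + k\<close> moves its distribution
  function by at most \<^term>\<open>k / c\<close>: at \<^term>\<open>z\<close> the change is at most \<open>exp (- y) * (x - y)\<close> where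
  \<open>x = z / c\<close> and \<open>y = z / (c + k)\<close>, here \<open>c * (x - y) = k * y\<close>, and \<open>y * exp (- y) \<le> 1\<close>.\<close>

lemma std_exponential_cdf_scale:
  fixes z c k :: real
  defines "R \<equiv> \<lambda>c. \<integral>u. indicator {..z} (c * u) \<partial>std_exponential"
  assumes "0 < c" "0 \<le> k"
  shows "c * \<bar>R (c + k) - R c\<bar> \<le> k"
proof -
  have R: "R c = (if 0 \<le> z then 1 - exp (- (z / c)) else 0)" if "0 < c" for c
  proof -
    have "R c = (\<integral>u. indicator {..z / c} u \<partial>std_exponential)"
      unfolding R_def using that by (intro Bochner_Integration.integral_cong) (auto simp: indicator_def field_simps)
    then show ?thesis
      using that unfolding integral_std_exponential_atMost by (simp add: zero_le_divide_iff)
  qed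
  show ?thesis
  proof (cases "0 \<le> z")
    case True
    define x y where "x = z / c" and "y = z / (c + k)"
    have xy: "0 \<le> y" "y \<le> x" using True assms(2,3) by (auto simp: x_def y_def intro!: divide_left_mono)
    have "c * x = z" "(c + k) * y = z" using assms(2,3) by (auto simp: x_def y_def)
    then have gap: "c * (x - y) = k * y" by (simp add: algebra_simps)
    have "c * \<bar>R (c + k) - R c\<bar> = c * (exp (- y) - exp (- x))"
      using True xy(2) assms(2,3) by (simp add: R x_def y_def)
    also have "exp (- y) - exp (- x) = exp (- y) * (1 - exp (y - x))"
      by (simp add: algebra_simps flip: exp_add)
    also have "c * \<dots> \<le> c * (exp (- y) * (x - y))"
    proof (intro mult_left_mono)
      show "1 - exp (y - x) \<le> x - y" using exp_ge_add_one_self[of "y - x"] by linarith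
    qed (use assms(2) in auto)
    also have "\<dots> = exp (- y) * (c * (x - y))" by simp
    also have "\<dots> = k * (exp (- y) * y)" unfolding gap by simp
    also have "\<dots> \<le> k * 1"
    proof (rule mult_left_mono)
      have "y \<le> exp y" using exp_ge_add_one_self[of y] by linarith
      then show "exp (- y) * y \<le> 1" by (simp add: exp_minus field_simps)
    qed (rule assms(3))
    finally show ?thesis by simp
  qed (use assms R in simp)
qed

lemma std_exponential_cdf_reflect:
  assumes "c \<noteq> 0"
  shows "(\<integral>u. indicator {..z} (- c * u) \<partial>std_exponential)
     = 1 - (\<integral>u. indicator {..- z} (c * u) \<partial>std_exponential :: real)"
proof -
  have "AE u in std_exponential. u \<noteq> - z / c"
    using AE_lborel_singleton[of "- z / c"] by (subst AE_density) (auto elim: AE_mp)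
  then have "(\<integral>u. indicator {..z} (- c * u) \<partial>std_exponential)
      = (\<integral>u. 1 - indicator {..- z} (c * u) \<partial>std_exponential :: real)"
  proof (intro integral_cong_AE)
    assume "AE u in std_exponential. u \<noteq> - z / c"
    then show "AE u in std_exponential. indicator {..z} (- c * u) = 1 - (indicator {..- z} (c * u) :: real)"
    proof eventually_elim
      case (elim u)
      then have "c * u \<noteq> - z" using assms by (auto simp: field_simps)
      then show ?case by (auto simp: indicator_def)
    qed
  qed auto
  also have "\<dots> = 1 - (\<integral>u. indicator {..- z} (c * u) \<partial>std_exponential :: real)"
    by (subst Bochner_Integration.integral_diff)
      (auto intro!: std_exponential.integrable_const_bound[where B=1] simp: std_exponential.prob_space)
  finally show ?thesis .
qed

text \<open>Each change of scale contributes at most \<open>k / S\<close> with \<open>S = sqrt (2 * b\<^sup>2 + a\<^sup>2)\<close>, and so does the change of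
  weights, as two probabilities differ by at most one. The sum \<open>3 * k / S\<close> is then bounded through
  \<open>2 * k \<le> \<tau>\<^sup>2 / S\<close> and \<open>2 * b\<^sup>2 \<le> S\<^sup>2\<close>.\<close>

lemma integral_AL_diff_atMost:
  assumes b: "0 < b"
  shows "\<bar>(\<integral>x. AL_density a (sqrt (b\<^sup>2 + \<tau>\<^sup>2)) x * indicator {..z} x \<partial>lborel)
      - (\<integral>x. AL_density a b x * indicator {..z} x \<partial>lborel)\<bar> \<le> 3 / 4 * (\<tau>\<^sup>2 / b\<^sup>2)"
proof -
  define S where "S = sqrt (2 * b\<^sup>2 + a\<^sup>2)"
  obtain k where k: "0 \<le> k" "2 * k \<le> \<tau>\<^sup>2 / S"
    "AL_mean_right a (sqrt (b\<^sup>2 + \<tau>\<^sup>2)) = AL_mean_right a b + k"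
    "AL_mean_left a (sqrt (b\<^sup>2 + \<tau>\<^sup>2)) = AL_mean_left a b + k"
    using AL_mean_increment[OF b] unfolding S_def by metis
  have b': "0 < sqrt (b\<^sup>2 + \<tau>\<^sup>2)" using b by (simp add: add_pos_nonneg)
  define m l where ml: "m = AL_mean_right a b" "l = AL_mean_left a b"
  have pos: "0 < m" "0 < l" using AL_mean_pos[OF b] by (auto simp: ml)
  have S: "m + l = S" by (simp add: ml S_def AL_mean_sum)
  define R where "R c = (\<integral>u. indicator {..z} (c * u) \<partial>std_exponential :: real)" for c
  have int: "integrable std_exponential (\<lambda>u. indicator {..z} (c * u) :: real)" for c
    by (rule std_exponential.integrable_const_bound[where B=1]) auto
  have R01: "0 \<le> R c" "R c \<le> 1" for c
  proof -
    show "0 \<le> R c" unfolding R_def by (rule Bochner_Integration.integral_nonneg) simp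
    have "R c \<le> (\<integral>u. 1 \<partial>std_exponential)"
      unfolding R_def by (rule integral_mono[OF int]) (auto simp: indicator_def)
    then show "R c \<le> 1" by (simp add: std_exponential.prob_space)
  qed
  have "\<bar>(\<integral>x. two_sided_exp_density (m + k) (l + k) x * indicator {..z} x \<partial>lborel) -
          (\<integral>x. two_sided_exp_density m l x * indicator {..z} x \<partial>lborel)\<bar>
     \<le> (k + k) / (m + l) + k * 1 / (m + l + 2 * k)"
  proof (rule integral_two_sided_exp_diff_le[OF pos k(1) _ int])
    show "m * \<bar>(\<integral>u. indicator {..z} ((m + k) * u) \<partial>std_exponential) - (\<integral>u. indicator {..z} (m * u) \<partial>std_exponential)\<bar> \<le> k"
      by (rule std_exponential_cdf_scale[OF pos(1) k(1)])
    have "l * \<bar>(\<integral>u. indicator {..- z} ((l + k) * u) \<partial>std_exponential) - (\<integral>u. indicator {..- z} (l * u) \<partial>std_exponential)\<bar> \<le> k"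
      by (rule std_exponential_cdf_scale[OF pos(2) k(1)])
    moreover have "l \<noteq> 0" and "l + k \<noteq> 0" using pos k(1) by auto
    ultimately show "l * \<bar>(\<integral>u. indicator {..z} (- (l + k) * u) \<partial>std_exponential) - (\<integral>u. indicator {..z} (- l * u) \<partial>std_exponential)\<bar> \<le> k"
      unfolding std_exponential_cdf_reflect[OF \<open>l \<noteq> 0\<close>] std_exponential_cdf_reflect[OF \<open>l + k \<noteq> 0\<close>]
      by (simp add: abs_minus_commute)
    show "\<bar>(\<integral>u. indicator {..z} ((m + k) * u) \<partial>std_exponential) - (\<integral>u. indicator {..z} (- (l + k) * u) \<partial>std_exponential)\<bar> \<le> (1::real)"
      using R01[of "m + k"] R01[of "- (l + k)"] unfolding R_def by linarith
  qed auto
  also have "\<dots> \<le> (k + k) / S + k / S"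
    unfolding S using pos k(1) S by (intro add_mono) (auto intro!: divide_left_mono)
  also have "\<dots> = 3 / 2 * (2 * k / S)" by simp
  also have "\<dots> \<le> 3 / 2 * (\<tau>\<^sup>2 / S / S)"
    using k(2) pos S by (intro mult_left_mono divide_right_mono) auto
  also have "\<dots> = 3 / 2 * (\<tau>\<^sup>2 / (2 * b\<^sup>2 + a\<^sup>2))"
    by (simp add: S_def)
  also have "\<dots> \<le> 3 / 2 * (\<tau>\<^sup>2 / (2 * b\<^sup>2))"
    using b by (intro mult_left_mono divide_left_mono) (auto intro!: mult_pos_pos add_pos_nonneg)
  also have "\<dots> = 3 / 4 * (\<tau>\<^sup>2 / b\<^sup>2)" by simp
  finally show ?thesis
    unfolding AL_density_eq_two_sided_exp[OF b] AL_density_eq_two_sided_exp[OF b'] k(3,4) ml .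
qed

section \<open>Additive noise\<close>

text \<open>Conditioning on the noise gives \<open>P (X + Y \<le> z) = E (F (z - Y))\<close> for the distribution function \<open>F\<close>
  of \<open>X\<close>. As the density is Lipschitz, \<open>F\<close> has the first-order expansion
  \<open>F (z - y) = F z - p z * y\<close> up to \<open>L * y\<^sup>2\<close>, and the linear term has mean zero because the noise is
  centred.\<close>

lemma (in prob_space) cdf_add_indep_centered_noise:
  fixes X Y :: "'a \<Rightarrow> real" and p :: "real \<Rightarrow> real"
  assumes X: "distributed M lborel X (\<lambda>x. ennreal (p x))" and p: "\<And>x. 0 \<le> p x"
    and meas [measurable]: "p \<in> borel_measurable borel"
    and Lip: "\<And>x y. \<bar>p x - p y\<bar> \<le> L * \<bar>x - y\<bar>"
    and indep: "indep_var borel X borel Y"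
    and Y: "integrable M Y" "integrable M (\<lambda>\<omega>. (Y \<omega>)\<^sup>2)" "expectation Y = 0"
  shows "\<bar>expectation (\<lambda>\<omega>. indicator {..z} (X \<omega> + Y \<omega>)) - expectation (\<lambda>\<omega>. indicator {..z} (X \<omega>))\<bar>
     \<le> L * expectation (\<lambda>\<omega>. (Y \<omega>)\<^sup>2)"
proof -
  have [measurable]: "X \<in> borel_measurable M" "Y \<in> borel_measurable M"
    using indep_var_rv1[OF indep] indep_var_rv2[OF indep] by auto
  define F where "F t = (\<integral>x. p x * indicator {..t} x \<partial>lborel)" for t :: real
  have F: "F t = expectation (\<lambda>\<omega>. indicator {..t} (X \<omega>))" for t
    unfolding F_def by (rule distributed_integral[OF X]) (auto simp: p)
  have int_p: "integrable lborel p"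
    using distributed_integrable[OF X, of "\<lambda>_. 1"] p by simp
  have int_pI: "integrable lborel (\<lambda>x. p x * indicator A x)" if "A \<in> sets borel" for A
    using int_p that by (intro integrable_mult_indicator[of A lborel p, unfolded real_scaleR_def mult.commute[of "indicator _ _"]]) auto
  have L: "0 \<le> L" using order_trans[OF abs_ge_zero Lip[of 1 0]] by simp
  have incr: "\<bar>F t - F s - p w * (t - s)\<bar> \<le> L * (t - s)\<^sup>2" if "s \<le> t" "w \<in> {s..t}" for s t w
  proof -
    let ?I = "indicator {s<..t} :: real \<Rightarrow> real"
    have int_I: "integrable lborel ?I" using that by (intro integrable_real_indicator) auto
    have "F t - F s = (\<integral>x. p x * indicator {..t} x - p x * indicator {..s} x \<partial>lborel)"
      unfolding F_def by (intro Bochner_Integration.integral_diff[symmetric] int_pI) auto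
    also have "\<dots> = (\<integral>x. p x * ?I x \<partial>lborel)"
      using that by (intro Bochner_Integration.integral_cong) (auto simp: indicator_def)
    finally have "F t - F s = \<dots>" .
    moreover have "(\<integral>x. p w * ?I x \<partial>lborel) = p w * (t - s)" using that by simp
    ultimately have "F t - F s - p w * (t - s) = (\<integral>x. p x * ?I x \<partial>lborel) - (\<integral>x. p w * ?I x \<partial>lborel)"
      by (simp only:)
    also have "\<dots> = (\<integral>x. p x * ?I x - p w * ?I x \<partial>lborel)"
      using int_I by (intro Bochner_Integration.integral_diff[symmetric] int_pI) auto
    finally have "\<bar>F t - F s - p w * (t - s)\<bar> = \<bar>\<integral>x. p x * ?I x - p w * ?I x \<partial>lborel\<bar>" by simp
    also have "\<dots> \<le> (\<integral>x. \<bar>p x * ?I x - p w * ?I x\<bar> \<partial>lborel)" by (rule integral_abs_bound)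
    also have "\<dots> \<le> (\<integral>x. L * (t - s) * ?I x \<partial>lborel)"
    proof (rule integral_mono)
      show "integrable lborel (\<lambda>x. \<bar>p x * ?I x - p w * ?I x\<bar>)"
        using int_I by (intro integrable_abs Bochner_Integration.integrable_diff int_pI) auto
      fix x
      have "\<bar>p x - p w\<bar> \<le> L * (t - s)" if "x \<in> {s<..t}"
        by (rule order_trans[OF Lip mult_left_mono[OF _ L]]) (use that \<open>w \<in> {s..t}\<close> in auto)
      then show "\<bar>p x * ?I x - p w * ?I x\<bar> \<le> L * (t - s) * ?I x" by (auto simp: indicator_def)
    qed (use int_I in simp)
    also have "\<dots> = L * (t - s)\<^sup>2" using that by (simp add: power2_eq_square)
    finally show ?thesis .
  qed
  have second_order: "\<bar>F (z - y) - F z + p z * y\<bar> \<le> L * y\<^sup>2" for y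
  proof (cases "0 \<le> y")
    case True
    then have "\<bar>F z - F (z - y) - p z * (z - (z - y))\<bar> \<le> L * (z - (z - y))\<^sup>2" by (intro incr) auto
    then show ?thesis by (simp add: abs_le_iff algebra_simps)
  next
    case False
    then have "\<bar>F (z - y) - F z - p z * (z - y - z)\<bar> \<le> L * (z - y - z)\<^sup>2" by (intro incr) auto
    then show ?thesis by simp
  qed
  have F_meas [measurable]: "F \<in> borel_measurable borel"
    by (rule borel_measurable_mono) (auto simp: mono_def F intro!: integral_mono integrable_const_bound[where B=1] simp: indicator_def)
  have int_F: "integrable M (\<lambda>\<omega>. F (z - Y \<omega>))"
  proof (rule integrable_const_bound[where B=1])
    have "0 \<le> F t" "F t \<le> 1" for t
    proof -
      show "0 \<le> F t" unfolding F by (intro Bochner_Integration.integral_nonneg) auto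
      have "F t \<le> expectation (\<lambda>_. 1)"
        unfolding F by (intro integral_mono integrable_const_bound[where B=1]) (auto simp: indicator_def)
      then show "F t \<le> 1" by (simp add: prob_space)
    qed
    then show "AE \<omega> in M. norm (F (z - Y \<omega>)) \<le> 1" by auto
  qed simp
  interpret PX: prob_space "distr M borel X" by (rule prob_space_distr) simp
  interpret PY: prob_space "distr M borel Y" by (rule prob_space_distr) simp
  interpret P: pair_prob_space "distr M borel X" "distr M borel Y" ..
  have "expectation (\<lambda>\<omega>. (indicator {..z} (X \<omega> + Y \<omega>) :: real))
     = (\<integral>(x, y). (indicator {..z} (x + y) :: real) \<partial>distr M (borel \<Otimes>\<^sub>M borel) (\<lambda>\<omega>. (X \<omega>, Y \<omega>)))"
    by (subst integral_distr) (auto simp: case_prod_unfold)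
  also have "\<dots> = (\<integral>(x, y). (indicator {..z} (x + y) :: real) \<partial>(distr M borel X \<Otimes>\<^sub>M distr M borel Y))"
    using indep unfolding indep_var_distribution_eq by simp
  also have "\<dots> = (\<integral>y. (\<integral>x. (indicator {..z} (x + y) :: real) \<partial>distr M borel X) \<partial>distr M borel Y)"
    by (intro P.integral_snd[symmetric] P.integrable_const_bound[where B=1]) (auto simp: case_prod_unfold)
  also have "\<dots> = (\<integral>y. F (z - y) \<partial>distr M borel Y)"
  proof (rule Bochner_Integration.integral_cong)
    fix y
    have "(\<integral>x. (indicator {..z} (x + y) :: real) \<partial>distr M borel X) = expectation (\<lambda>\<omega>. (indicator {..z} (X \<omega> + y) :: real))"
      by (subst integral_distr) auto
    also have "\<dots> = F (z - y)"
      unfolding F by (intro Bochner_Integration.integral_cong) (auto simp: indicator_def)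
    finally show "(\<integral>x. (indicator {..z} (x + y) :: real) \<partial>distr M borel X) = F (z - y)" .
  qed simp
  also have "\<dots> = expectation (\<lambda>\<omega>. F (z - Y \<omega>))"
    by (subst integral_distr) auto
  finally have "expectation (\<lambda>\<omega>. (indicator {..z} (X \<omega> + Y \<omega>) :: real)) - F z
      = expectation (\<lambda>\<omega>. F (z - Y \<omega>) - F z + p z * Y \<omega>)"
    using int_F Y by (simp add: prob_space)
  also have "\<bar>\<dots>\<bar> \<le> expectation (\<lambda>\<omega>. \<bar>F (z - Y \<omega>) - F z + p z * Y \<omega>\<bar>)"
    by (rule integral_abs_bound)
  also have "\<dots> \<le> expectation (\<lambda>\<omega>. L * (Y \<omega>)\<^sup>2)"
    using int_F Y second_order by (intro integral_mono) auto
  also have "\<dots> = L * expectation (\<lambda>\<omega>. (Y \<omega>)\<^sup>2)" by simp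
  finally show ?thesis unfolding F .
qed

lemma (in prob_space) expectation_abs_le_sqrt_second_moment:
  fixes X :: "'a \<Rightarrow> real" and \<tau> :: real
  assumes "0 < \<tau>" "integrable M X" "integrable M (\<lambda>\<omega>. (X \<omega>)\<^sup>2)" "expectation (\<lambda>\<omega>. (X \<omega>)\<^sup>2) = \<tau>\<^sup>2"
  shows "expectation (\<lambda>\<omega>. \<bar>X \<omega>\<bar>) \<le> \<tau>"
proof -
  \<comment> \<open>Expand the square of \<open>\<bar>x\<bar> - \<tau>\<close>.\<close>
  have "\<bar>x\<bar> \<le> (x\<^sup>2 + \<tau>\<^sup>2) / (2 * \<tau>)" for x :: real
    using zero_le_power2[of "\<bar>x\<bar> - \<tau>"] assms(1) by (simp add: power2_diff field_simps power2_eq_square)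
  then have "expectation (\<lambda>\<omega>. \<bar>X \<omega>\<bar>) \<le> expectation (\<lambda>\<omega>. ((X \<omega>)\<^sup>2 + \<tau>\<^sup>2) / (2 * \<tau>))"
    using assms by (intro integral_mono) auto
  also have "\<dots> = \<tau>" using assms by (simp add: prob_space power2_eq_square)
  finally show ?thesis .
qed

lemma (in prob_space) expectation_abs_normal:
  assumes "0 < \<tau>" "distributed M lborel X (\<lambda>x. ennreal (normal_density 0 \<tau> x))"
  shows "expectation (\<lambda>\<omega>. \<bar>X \<omega>\<bar>) = sqrt (2 / pi) * \<tau>"
proof -
  have "expectation (\<lambda>\<omega>. \<bar>X \<omega>\<bar>) = (\<integral>x. normal_density 0 \<tau> x * \<bar>x\<bar> \<partial>lborel)"
    by (rule distributed_integral[OF assms(2), symmetric]) (auto simp: normal_density_nonneg)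
  then show ?thesis
    using integral_normal_moment_abs_odd[OF assms(1), of 0 0] by simp
qed

section \<open>Distances from the noisy law to the asymmetric Laplace law\<close>

lemma Wasserstein_AL_noise_le:
  fixes M :: "'a measure" and N :: "'b measure" and X Y :: "'a \<Rightarrow> real" and Z :: "'b \<Rightarrow> real"
  assumes "prob_space M" and b: "0 < b"
    and X: "distributed M lborel X (\<lambda>x. ennreal (AL_density a b x))"
    and Y: "integrable M Y"
    and Z: "distributed N lborel Z (\<lambda>x. ennreal (AL_density a (sqrt (b\<^sup>2 + \<tau>\<^sup>2)) x))"
  shows "d_W M (\<lambda>\<omega>. X \<omega> + Y \<omega>) N Z
    \<le> ereal ((\<integral>\<omega>. \<bar>Y \<omega>\<bar> \<partial>M) + \<tau>\<^sup>2 / sqrt (2 * b\<^sup>2 + a\<^sup>2))"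
  unfolding d_W_def ipm_def
proof (rule SUP_least)
  interpret prob_space M by fact
  fix h assume "h \<in> H_W"
  then have h: "\<bar>h x - h y\<bar> \<le> \<bar>x - y\<bar>" for x y by (rule H_W_contraction)
  note [measurable] = contraction_borel[OF h]
  have X_meas [measurable]: "X \<in> borel_measurable M" using X by (auto simp: distributed_def)
  note Y_meas [measurable] = borel_measurable_integrable[OF Y]
  have eX: "expectation (\<lambda>\<omega>. h (X \<omega>)) = (\<integral>x. AL_density a b x * h x \<partial>lborel)"
    by (rule distributed_integral[OF X, symmetric]) (auto simp: AL_density_nonneg)
  have eZ: "(\<integral>\<omega>. h (Z \<omega>) \<partial>N) = (\<integral>x. AL_density a (sqrt (b\<^sup>2 + \<tau>\<^sup>2)) x * h x \<partial>lborel)"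
    by (rule distributed_integral[OF Z, symmetric]) (auto simp: AL_density_nonneg)
  have iX: "integrable M (\<lambda>\<omega>. h (X \<omega>))"
    using integrable_AL_contraction[OF b h]
    by (subst distributed_integrable[OF X, symmetric]) (auto simp: AL_density_nonneg)
  have near: "\<bar>h (X \<omega> + Y \<omega>) - h (X \<omega>)\<bar> \<le> \<bar>Y \<omega>\<bar>" for \<omega>
    using h[of "X \<omega> + Y \<omega>" "X \<omega>"] by simp
  have iD: "integrable M (\<lambda>\<omega>. h (X \<omega> + Y \<omega>) - h (X \<omega>))"
    by (rule Bochner_Integration.integrable_bound[OF Y]) (use near in auto)
  have iXY: "integrable M (\<lambda>\<omega>. h (X \<omega> + Y \<omega>))"
    using Bochner_Integration.integrable_add[OF iD iX] by simp
  have "\<bar>expectation (\<lambda>\<omega>. h (X \<omega> + Y \<omega>)) - expectation (\<lambda>\<omega>. h (X \<omega>))\<bar>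
      = \<bar>expectation (\<lambda>\<omega>. h (X \<omega> + Y \<omega>) - h (X \<omega>))\<bar>"
    using iX iXY by simp
  also have "\<dots> \<le> expectation (\<lambda>\<omega>. \<bar>h (X \<omega> + Y \<omega>) - h (X \<omega>)\<bar>)"
    by (rule integral_abs_bound)
  also have "\<dots> \<le> expectation (\<lambda>\<omega>. \<bar>Y \<omega>\<bar>)"
    using near Y by (intro integral_mono integrable_abs iD) auto
  finally show "ereal \<bar>expectation (\<lambda>\<omega>. h (X \<omega> + Y \<omega>)) - (\<integral>\<omega>. h (Z \<omega>) \<partial>N)\<bar>
      \<le> ereal ((\<integral>\<omega>. \<bar>Y \<omega>\<bar> \<partial>M) + \<tau>\<^sup>2 / sqrt (2 * b\<^sup>2 + a\<^sup>2))"
    using integral_AL_diff_contraction[OF b h, of a \<tau>] unfolding eX eZ by simp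
qed

text \<open>The noise contributes \<open>2 * \<tau>\<^sup>2 / b\<^sup>2\<close> and the change of parameter \<open>3 / 4 * \<tau>\<^sup>2 / b\<^sup>2\<close>. This is a
  bound in terms of \<open>b\<^sup>2 + \<tau>\<^sup>2\<close> only when \<open>\<tau>\<^sup>2\<close> is small compared with \<open>b\<^sup>2\<close>; otherwise the right-hand
  side is at least one, and the Kolmogorov distance never exceeds one.\<close>

lemma Kolmogorov_AL_noise_le:
  fixes M :: "'a measure" and N :: "'b measure" and X Y :: "'a \<Rightarrow> real" and Z :: "'b \<Rightarrow> real"
  assumes "prob_space M" and "prob_space N" and b: "0 < b"
    and X: "distributed M lborel X (\<lambda>x. ennreal (AL_density a b x))"
    and indep: "prob_space.indep_var M borel X borel Y"
    and Y: "integrable M Y" "integrable M (\<lambda>\<omega>. (Y \<omega>)\<^sup>2)"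
      "(\<integral>\<omega>. Y \<omega> \<partial>M) = 0" "(\<integral>\<omega>. (Y \<omega>)\<^sup>2 \<partial>M) = \<tau>\<^sup>2"
    and Z: "distributed N lborel Z (\<lambda>x. ennreal (AL_density a (sqrt (b\<^sup>2 + \<tau>\<^sup>2)) x))"
  shows "d_K M (\<lambda>\<omega>. X \<omega> + Y \<omega>) N Z \<le> ereal (5 * (\<tau>\<^sup>2 / (b\<^sup>2 + \<tau>\<^sup>2)))"
  unfolding d_K_def ipm_def
proof (rule SUP_least)
  interpret prob_space M by fact
  interpret N: prob_space N by fact
  fix h :: "real \<Rightarrow> real" assume "h \<in> H_K"
  then obtain z where h: "h = indicator {..z}" unfolding H_K_def by auto
  have [measurable]: "X \<in> borel_measurable M" "Y \<in> borel_measurable M" "Z \<in> borel_measurable N"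
    using indep_var_rv1[OF indep] indep_var_rv2[OF indep] Z by (auto simp: distributed_def)
  let ?p = "expectation (\<lambda>\<omega>. h (X \<omega> + Y \<omega>))" and ?q = "\<integral>\<omega>. h (Z \<omega>) \<partial>N"
  have eX: "expectation (\<lambda>\<omega>. h (X \<omega>)) = (\<integral>x. AL_density a b x * h x \<partial>lborel)"
    unfolding h by (rule distributed_integral[OF X, symmetric]) (auto simp: AL_density_nonneg)
  have eZ: "?q = (\<integral>x. AL_density a (sqrt (b\<^sup>2 + \<tau>\<^sup>2)) x * h x \<partial>lborel)"
    unfolding h by (rule distributed_integral[OF Z, symmetric]) (auto simp: AL_density_nonneg)
  have smooth: "\<bar>?p - expectation (\<lambda>\<omega>. h (X \<omega>))\<bar> \<le> 2 / b\<^sup>2 * \<tau>\<^sup>2"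
    unfolding h Y(4)[symmetric]
    by (rule cdf_add_indep_centered_noise[OF X _ _ AL_density_Lipschitz[OF b] indep Y(1-3)])
      (auto simp: AL_density_nonneg)
  have small: "\<bar>?p - ?q\<bar> \<le> 11 / 4 * (\<tau>\<^sup>2 / b\<^sup>2)"
  proof -
    have "\<bar>?q - expectation (\<lambda>\<omega>. h (X \<omega>))\<bar> \<le> 3 / 4 * (\<tau>\<^sup>2 / b\<^sup>2)"
      unfolding eX eZ unfolding h by (rule integral_AL_diff_atMost[OF b])
    moreover have "2 / b\<^sup>2 * \<tau>\<^sup>2 = 2 * (\<tau>\<^sup>2 / b\<^sup>2)" by simp
    ultimately show ?thesis using smooth by linarith
  qed
  have trivial: "\<bar>?p - ?q\<bar> \<le> 1"
  proof -
    have "0 \<le> ?p" "0 \<le> ?q" unfolding h by (auto intro!: Bochner_Integration.integral_nonneg)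
    moreover have "?p \<le> expectation (\<lambda>_. 1)"
      unfolding h by (intro integral_mono integrable_const_bound[where B=1]) (auto simp: indicator_def)
    moreover have "?q \<le> N.expectation (\<lambda>_. 1)"
      unfolding h by (intro integral_mono N.integrable_const_bound[where B=1]) (auto simp: indicator_def)
    ultimately show ?thesis by (simp add: prob_space N.prob_space)
  qed
  have "\<bar>?p - ?q\<bar> \<le> 5 * (\<tau>\<^sup>2 / (b\<^sup>2 + \<tau>\<^sup>2))"
  proof (cases "b\<^sup>2 + \<tau>\<^sup>2 \<le> 5 * \<tau>\<^sup>2")
    case True
    moreover have "0 < b\<^sup>2 + \<tau>\<^sup>2" using b by (simp add: add_pos_nonneg)
    ultimately have "1 \<le> 5 * (\<tau>\<^sup>2 / (b\<^sup>2 + \<tau>\<^sup>2))" by (simp add: field_simps)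
    with trivial show ?thesis by linarith
  next
    case False
    have b2: "0 < b\<^sup>2" "0 < b\<^sup>2 + \<tau>\<^sup>2" using b by (auto simp: add_pos_nonneg)
    have "11 / 4 * \<tau>\<^sup>2 * (b\<^sup>2 + \<tau>\<^sup>2) \<le> 5 * \<tau>\<^sup>2 * b\<^sup>2"
    proof -
      have "\<tau>\<^sup>2 * (11 / 4 * (b\<^sup>2 + \<tau>\<^sup>2)) \<le> \<tau>\<^sup>2 * (5 * b\<^sup>2)"
        using False b2 by (intro mult_left_mono) auto
      then show ?thesis by (simp add: algebra_simps)
    qed
    then have "11 / 4 * (\<tau>\<^sup>2 / b\<^sup>2) \<le> 5 * (\<tau>\<^sup>2 / (b\<^sup>2 + \<tau>\<^sup>2))"
      using b2 by (simp add: field_simps)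
    with small show ?thesis by linarith
  qed
  then show "ereal \<bar>?p - ?q\<bar> \<le> ereal (5 * (\<tau>\<^sup>2 / (b\<^sup>2 + \<tau>\<^sup>2)))" by simp
qed

theorem theorem4p1:
  fixes M :: "'a measure" and N :: "'b measure"
    and Z' \<eta> W :: "'a \<Rightarrow> real" and Z :: "'b \<Rightarrow> real"
    and a b \<tau> c d :: real
  assumes "prob_space M" and "prob_space N"
    and "b > 0" and "\<tau> > 0"
    and "distributed M lborel Z' (\<lambda>x. ennreal (AL_density a b x))"
    and "\<eta> \<in> borel_measurable M"
    and "prob_space.indep_var M borel Z' borel \<eta>"
    and "integrable M (\<lambda>\<omega>. (\<eta> \<omega>)\<^sup>2)"
    and "prob_space.expectation M \<eta> = 0"
    and "prob_space.variance M \<eta> = \<tau>\<^sup>2"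
    and "W = (\<lambda>\<omega>. Z' \<omega> + \<eta> \<omega>)"
    and "distributed N lborel Z (\<lambda>x. ennreal (AL_density a (sqrt (b\<^sup>2 + \<tau>\<^sup>2)) x))"
    and "c = 14 / sqrt (a\<^sup>2 + 2 * b\<^sup>2 + 2 * \<tau>\<^sup>2) + 7 * \<bar>a\<bar> / (b\<^sup>2 + \<tau>\<^sup>2)"
    and "d = 5 + 7 * \<bar>a\<bar> / sqrt (a\<^sup>2 + 2 * b\<^sup>2 + 2 * \<tau>\<^sup>2)"
  shows
    "(d_K M W N Z
        \<le> ereal (1.05 * (b\<^sup>2 * c\<^sup>2 * d * \<tau>\<^sup>2 / (b\<^sup>2 + \<tau>\<^sup>2)) powr (1 / 3) + d * \<tau>\<^sup>2 / (b\<^sup>2 + \<tau>\<^sup>2))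
      \<and> d_W M W N Z \<le> ereal (\<tau> + \<tau>\<^sup>2 / sqrt (2 * b\<^sup>2 + a\<^sup>2)))
     \<and>
     (\<forall>(n::real) (C::real). n \<ge> 2 \<longrightarrow> C > 0 \<longrightarrow>
        (\<forall>s>0. measure M {\<omega> \<in> space M. \<bar>\<eta> \<omega>\<bar> > s} \<le> C * \<tau> powr n / s powr n) \<longrightarrow>
        d_K M W N Z
          \<le> ereal (2 * (2 * b\<^sup>2 * c powr n * C * d * \<tau> powr n /
                      ((b\<^sup>2 + \<tau>\<^sup>2) * (n\<^sup>2 + 3 * n + 2))) powr (1 / (n + 1))
                    + d * \<tau>\<^sup>2 / (b\<^sup>2 + \<tau>\<^sup>2)))
     \<and>
     (\<tau> < 1 \<longrightarrow> distributed M lborel \<eta> (\<lambda>x. ennreal (normal_density 0 \<tau> x)) \<longrightarrow>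
        d_K M W N Z
          \<le> ereal ((2 * c + b\<^sup>2 * d / (2 * sqrt (2 * pi) * (b\<^sup>2 + \<tau>\<^sup>2) * ln (1 / \<tau>)))
                      * \<tau> * sqrt (ln (1 / \<tau>))
                    + d * \<tau>\<^sup>2 / (b\<^sup>2 + \<tau>\<^sup>2))
        \<and> d_W M W N Z \<le> ereal (sqrt (2 / pi) * \<tau> + \<tau>\<^sup>2 / sqrt (2 * b\<^sup>2 + a\<^sup>2)))"
proof -
  interpret prob_space M by fact
  note b = \<open>0 < b\<close> and tau = \<open>0 < \<tau>\<close>
  have eta: "integrable M \<eta>" by (rule square_integrable_imp_integrable[OF assms(6,8)])
  have second_moment: "expectation (\<lambda>\<omega>. (\<eta> \<omega>)\<^sup>2) = \<tau>\<^sup>2" using assms(9,10) by simp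
  let ?S = "sqrt (a\<^sup>2 + 2 * b\<^sup>2 + 2 * \<tau>\<^sup>2)" and ?K = "d * \<tau>\<^sup>2 / (b\<^sup>2 + \<tau>\<^sup>2)"
  have c: "0 \<le> c" and d: "5 \<le> d" unfolding assms(13,14) by simp_all
  have "5 * (\<tau>\<^sup>2 / (b\<^sup>2 + \<tau>\<^sup>2)) \<le> d * (\<tau>\<^sup>2 / (b\<^sup>2 + \<tau>\<^sup>2))"
    using d by (rule mult_right_mono) simp
  then have K: "d_K M W N Z \<le> ereal ?K"
    using Kolmogorov_AL_noise_le[OF assms(1,2) b assms(5,7) eta assms(8,9) second_moment assms(12)]
    unfolding assms(11) by (simp add: order_trans[OF _ ereal_less_eq(3)[THEN iffD2]])
  have weaken: "d_K M W N Z \<le> ereal (e + ?K)" if "0 \<le> e" for e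
    by (rule order_trans[OF K]) (use that in simp)
  have W: "d_W M W N Z \<le> ereal (e + \<tau>\<^sup>2 / sqrt (2 * b\<^sup>2 + a\<^sup>2))"
    if "expectation (\<lambda>\<omega>. \<bar>\<eta> \<omega>\<bar>) \<le> e" for e
    unfolding assms(11)
    by (rule order_trans[OF Wasserstein_AL_noise_le[OF assms(1) b assms(5) eta assms(12)]]) (use that in simp)
  have log_term: "0 \<le> (2 * c + b\<^sup>2 * d / (2 * sqrt (2 * pi) * (b\<^sup>2 + \<tau>\<^sup>2) * ln (1 / \<tau>))) * \<tau> * sqrt (ln (1 / \<tau>))"
    if "\<tau> < 1"
  proof -
    have "0 < ln (1 / \<tau>)" using that tau by simp
    then show ?thesis using c d tau
      by (intro mult_nonneg_nonneg add_nonneg_nonneg divide_nonneg_nonneg) auto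
  qed
  show ?thesis
    using expectation_abs_le_sqrt_second_moment[OF tau eta assms(8) second_moment]
      expectation_abs_normal[OF tau] log_term
    by (intro conjI allI impI weaken W) simp_all
qed

end
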